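(* Suppose $a_k=A$, $b_k=B$, $\lambda_k=C$ for all $k\ge0$. Then for every $n\ge0$, \[ \det(\mu_{i+j})_{i,j=0}^n=(A^2+AB+C)^{\binom{n+1}{2}}, \] where $\mu_k=\mathcal{L}(x^k)$.
   Context: Let $A,B,C$ be complex numbers with $A\neq 0$. Define monic polynomials $P_n(x)$ by $P_{-1}(x)=0$, $P_0(x)=1$ and $P_{n+1}(x)=(x-B)P_n(x)-(Ax+C)P_{n-1}(x)$ for $n\ge0$, and assume $P_n(-C/A)\neq0$ for all $n\ge1$. Let $d_m(x)=(Ax+C)^m$ and $Q_m(x)=P_m(x)/d_m(x)$. Let $V=\mathrm{span}\{x^nQ_m(x):n,m\ge0\}$ (rational functions) and let $\mathcal{L}$ be the unique linear functional on $V$ with $\mathcal{L}(1)=1$ and $\mathcal{L}(x^nQ_m(x))=0$ whenever $0\le n<m$. *)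

theory Defs
  imports
    "HOL-Computational_Algebra.Polynomial_Factorial"
    "Jordan_Normal_Form.Determinant"
begin

text \<open>
  Rational functions over the complex numbers are elements of the fraction field of
  \<open>complex poly\<close>, regarded as a complex vector space.
\<close>

type_synonym ratfun = "complex poly fract"

definition ratfun_scale :: "complex \<Rightarrow> ratfun \<Rightarrow> ratfun" where
  "ratfun_scale c r = to_fract [:c:] * r"

global_interpretation ratfun: Vector_Spaces.vector_space ratfun_scale
proof
  fix a b :: complex and x y :: ratfun
  show "ratfun_scale a (x + y) = ratfun_scale a x + ratfun_scale a y"
    by (simp add: ratfun_scale_def distrib_left)
  have "to_fract [:a + b:] = to_fract [:a:] + to_fract [:b:]"
    by (simp flip: to_fract_add)
  then show "ratfun_scale (a + b) x = ratfun_scale a x + ratfun_scale b x"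
    by (simp add: ratfun_scale_def distrib_right)
  have "to_fract [:a * b:] = to_fract [:a:] * to_fract [:b:]"
    by (simp flip: to_fract_mult)
  then show "ratfun_scale a (ratfun_scale b x) = ratfun_scale (a * b) x"
    by (simp add: ratfun_scale_def)
  show "ratfun_scale 1 x = x"
    by (simp add: ratfun_scale_def flip: one_pCons)
qed

definition ratfun_X :: ratfun where
  "ratfun_X = to_fract [:0, 1:]"

text \<open>
  The second equation is the recurrence at index zero with the convention that the
  polynomial of index minus one is zero.
\<close>

fun RI_poly :: "complex \<Rightarrow> complex \<Rightarrow> complex \<Rightarrow> nat \<Rightarrow> complex poly" where
  "RI_poly A B C 0 = 1"
| "RI_poly A B C (Suc 0) = [:- B, 1:]"
| "RI_poly A B C (Suc (Suc n)) =
     [:- B, 1:] * RI_poly A B C (Suc n) - [:C, A:] * RI_poly A B C n"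

definition RI_denom :: "complex \<Rightarrow> complex \<Rightarrow> nat \<Rightarrow> complex poly" where
  "RI_denom A C m = [:C, A:] ^ m"

definition RI_ratfun :: "complex \<Rightarrow> complex \<Rightarrow> complex \<Rightarrow> nat \<Rightarrow> ratfun" where
  "RI_ratfun A B C m = to_fract (RI_poly A B C m) / to_fract (RI_denom A C m)"

definition RI_space :: "complex \<Rightarrow> complex \<Rightarrow> complex \<Rightarrow> ratfun set" where
  "RI_space A B C = ratfun.span {ratfun_X ^ n * RI_ratfun A B C m | n m. True}"

text \<open>
  A functional on a subspace \<open>V\<close> is a total function whose values outside \<open>V\<close> are irrelevant.
\<close>

definition linear_functional_on :: "ratfun set \<Rightarrow> (ratfun \<Rightarrow> complex) \<Rightarrow> bool" where
  "linear_functional_on V L \<longleftrightarrow>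
     (\<forall>u\<in>V. \<forall>v\<in>V. L (u + v) = L u + L v) \<and>
     (\<forall>c. \<forall>u\<in>V. L (ratfun_scale c u) = c * L u)"

end

theory Submission
  imports Defs "HOL-Computational_Algebra.Formal_Power_Series"
begin

text \<open>
  Put \<open>\<nu> k m = L (x\<^sup>k Q\<^sub>m)\<close>. Dividing the recurrence of the \<open>P\<^sub>m\<close> by powers of \<open>Ax + C\<close> gives
  \<open>\<nu> (k+1) m - A \<nu> (k+1) (m+1) = \<nu> k (m-1) + B \<nu> k m + C \<nu> k (m+1)\<close>.
  Pair a power series \<open>f(s)\<close> with the row \<open>\<nu> k\<close> by \<open>\<langle>f, k\<rangle> = \<Sum>\<^sub>m f\<^sub>m \<nu> k m\<close>, a finite sum as \<open>\<nu> k m = 0\<close>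
  for \<open>k < m\<close>. With \<open>\<lambda> = A\<^sup>2 + AB + C\<close> and \<open>g = \<lambda>s / (1 - As)\<close>, so that \<open>\<lambda>/g = 1/s - A\<close>, the
  recurrence becomes \<open>\<langle>g\<^sup>j, k+1\<rangle> = \<langle>g\<^sup>j\<^sup>+\<^sup>1 + b\<^sub>j g\<^sup>j + \<lambda> g\<^sup>j\<^sup>-\<^sup>1, k\<rangle>\<close> with \<open>b\<^sub>0 = A + B\<close> and
  \<open>b\<^sub>j = 2A + B\<close> for \<open>j \<ge> 1\<close>. Hence \<open>\<langle>g\<^sup>j, k\<rangle> = L (x\<^sup>k p\<^sub>j)\<close> for the monic polynomials \<open>p\<^sub>j\<close>
  with these recurrence coefficients. It vanishes for \<open>k < j\<close> and equals \<open>\<lambda>\<^sup>j\<close> for \<open>k = j\<close>, so the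
  \<open>p\<^sub>j\<close> are orthogonal and the Hankel determinant is \<open>\<lambda>\<^sup>0\<^sup>+\<^sup>1\<^sup>+\<^sup>\<dots>\<^sup>+\<^sup>n\<close>.
\<close>

section \<open>Hankel determinants from a three-term recurrence\<close>

lemma det_Hankel_three_term:
  fixes \<mu> :: "nat \<Rightarrow> 'a :: idom"
  assumes zero: "\<And>k. \<sigma> k 0 = \<mu> k"
    and one: "\<And>k. \<sigma> (Suc k) 0 = \<sigma> k 1 + b 0 * \<sigma> k 0"
    and rec: "\<And>k j. \<sigma> (Suc k) (Suc j) = \<sigma> k (Suc (Suc j)) + b (Suc j) * \<sigma> k (Suc j) + l j * \<sigma> k j"
    and tri: "\<And>k j. k < j \<Longrightarrow> \<sigma> k j = 0"
  shows "det (mat n n (\<lambda>(i, j). \<mu> (i + j))) = (\<Prod>j<n. \<sigma> j j)"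
proof -
  \<comment> \<open>\<open>c\<close> lists the coefficients of the monic polynomial
    \<open>p_j\<close>; \<open>\<sigma> k j\<close> plays the functional with moments
    \<open>\<mu>\<close> applied to \<open>x^k p_j\<close>.\<close>
  define P where "P j c \<longleftrightarrow> c j = 1 \<and> (\<forall>i>j. c i = 0) \<and> (\<forall>k. \<sigma> k j = (\<Sum>i\<le>j. c i * \<mu> (k + i)))"
    for j and c :: "nat \<Rightarrow> 'a"
  have extend: "\<sigma> k j = (\<Sum>i\<le>N. c i * \<mu> (k + i))" if "P j c" "j \<le> N" for k j c N
  proof -
    have "(\<Sum>i\<le>N. c i * \<mu> (k + i)) = (\<Sum>i\<le>j. c i * \<mu> (k + i))"
      using that by (intro sum.mono_neutral_right) (auto simp: P_def)
    then show ?thesis using that by (simp add: P_def)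
  qed
  have shift: "\<sigma> (Suc k) j = (\<Sum>i\<le>Suc j. (case i of 0 \<Rightarrow> 0 | Suc i' \<Rightarrow> c i') * \<mu> (k + i))"
    if "P j c" for k j c
    using extend[OF that order_refl, of "Suc k"] by (subst sum.atMost_Suc_shift) simp
  \<comment> \<open>The recurrence has order two, so the induction carries two consecutive
    indices.\<close>
  have "(\<exists>c. P j c) \<and> (\<exists>c. P (Suc j) c)" for j
  proof (induction j)
    case 0
    define c where "c = (\<lambda>i::nat. if i = 0 then 1 else (0 :: 'a))"
    have c: "P 0 c" by (auto simp: P_def c_def zero)
    define d where "d = (\<lambda>i. (case i of 0 \<Rightarrow> 0 | Suc i' \<Rightarrow> c i') - b 0 * c i)"
    have "\<sigma> k 1 = (\<Sum>i\<le>1. d i * \<mu> (k + i))" for k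
    proof -
      have "\<sigma> k 1 = \<sigma> (Suc k) 0 - b 0 * \<sigma> k 0" by (simp add: one)
      then show ?thesis by (simp add: d_def c_def zero)
    qed
    then have "P (Suc 0) d"
      by (auto simp: P_def d_def c_def split: nat.split)
    with c show ?case by blast
  next
    case (Suc j)
    then obtain c d where c: "P j c" and d: "P (Suc j) d" by blast
    \<comment> \<open>These are the coefficients of
      \<open>(x - b_(j+1)) p_(j+1) - l_j p_j\<close>.\<close>
    define e where "e = (\<lambda>i. (case i of 0 \<Rightarrow> 0 | Suc i' \<Rightarrow> d i') - b (Suc j) * d i - l j * c i)"
    have "\<sigma> k (Suc (Suc j)) = (\<Sum>i\<le>Suc (Suc j). e i * \<mu> (k + i))" for k
    proof -
      have "\<sigma> k (Suc (Suc j)) = \<sigma> (Suc k) (Suc j) - b (Suc j) * \<sigma> k (Suc j) - l j * \<sigma> k j"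
        by (simp add: rec)
      also have "\<dots> = (\<Sum>i\<le>Suc (Suc j). e i * \<mu> (k + i))"
        unfolding shift[OF d, of k] extend[OF d le_SucI[OF order_refl], of k]
          extend[OF c le_SucI[OF le_SucI[OF order_refl]], of k] e_def
        by (simp add: sum_distrib_left sum_subtractf left_diff_distrib mult.assoc del: sum.atMost_Suc)
      finally show ?thesis .
    qed
    then have "P (Suc (Suc j)) e"
      using c d by (auto simp: P_def e_def split: nat.split)
    with d show ?case by blast
  qed
  then obtain c where c: "P j (c j)" for j by metis
  \<comment> \<open>Column \<open>j\<close> of \<open>U\<close> holds the coefficients of
    \<open>p_j\<close>. So \<open>U\<close> is unitriangular, while \<open>H * U\<close> has entries
    \<open>\<sigma> k j\<close> and is lower triangular by \<open>tri\<close>.\<close>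
  define H U where "H = mat n n (\<lambda>(i, j). \<mu> (i + j))" and "U = mat n n (\<lambda>(i, j). c j i)"
  have carrier: "H \<in> carrier_mat n n" "U \<in> carrier_mat n n" by (auto simp: H_def U_def)
  have HU: "H * U = mat n n (\<lambda>(k, j). \<sigma> k j)"
  proof (rule eq_matI)
    fix k j assume "k < dim_row (mat n n (\<lambda>(k, j). \<sigma> k j))" "j < dim_col (mat n n (\<lambda>(k, j). \<sigma> k j))"
    then have kj: "k < n" "j < n" by auto
    have "(H * U) $$ (k, j) = (\<Sum>i = 0..<n. \<mu> (k + i) * c j i)"
      using kj by (simp add: H_def U_def scalar_prod_def)
    also have "{0..<n} = {..n - 1}" using kj by auto
    also have "(\<Sum>i\<le>n - 1. \<mu> (k + i) * c j i) = \<sigma> k j"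
      using kj by (simp add: extend[OF c, of j "n - 1"] mult.commute)
    finally show "(H * U) $$ (k, j) = mat n n (\<lambda>(k, j). \<sigma> k j) $$ (k, j)" using kj by simp
  qed (auto simp: H_def U_def)
  have "det U = prod_list (diag_mat U)"
    using c by (intro det_upper_triangular[OF _ carrier(2)]) (auto simp: U_def P_def)
  also have "\<dots> = 1"
    using c by (simp add: prod_list_diag_prod U_def P_def)
  finally have "det H = det (H * U)" by (simp add: det_mult[OF carrier])
  also have "\<dots> = prod_list (diag_mat (H * U))"
    unfolding HU by (intro det_lower_triangular[of n]) (auto simp: tri)
  also have "\<dots> = (\<Prod>j<n. \<sigma> j j)"
    unfolding HU by (simp add: diag_mat_def prod.list_conv_set_nth atLeast0LessThan)
  finally show ?thesis by (simp add: H_def)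
qed

section \<open>The recurrence for \<open>\<nu>\<close> and its power series pairing\<close>

locale RI_moments =
  fixes A B C :: "'a :: field" and \<nu> :: "nat \<Rightarrow> nat \<Rightarrow> 'a"
  assumes vanish: "k < m \<Longrightarrow> \<nu> k m = 0"
    and rec_0: "\<nu> (Suc k) 0 - A * \<nu> (Suc k) 1 = B * \<nu> k 0 + C * \<nu> k 1"
    and rec_Suc: "\<nu> (Suc k) (Suc m) - A * \<nu> (Suc k) (Suc (Suc m))
      = \<nu> k m + B * \<nu> k (Suc m) + C * \<nu> k (Suc (Suc m))"
    and normalized: "\<nu> 0 0 = 1"
begin

definition pairing :: "'a fps \<Rightarrow> nat \<Rightarrow> 'a" where
  "pairing f k = (\<Sum>m\<le>k. fps_nth f m * \<nu> k m)"

lemma pairing_extend: "k \<le> N \<Longrightarrow> pairing f k = (\<Sum>m\<le>N. fps_nth f m * \<nu> k m)"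
  unfolding pairing_def by (intro sum.mono_neutral_left) (auto simp: vanish)

lemma pairing_add: "pairing (f + g) k = pairing f k + pairing g k"
  by (simp add: pairing_def sum.distrib distrib_right)

lemma pairing_diff: "pairing (f - g) k = pairing f k - pairing g k"
  by (simp add: pairing_def sum_subtractf left_diff_distrib)

lemma pairing_scale: "pairing (fps_const c * f) k = c * pairing f k"
  by (simp add: pairing_def sum_distrib_left mult.assoc)

lemma pairing_X_mult: "k \<le> N \<Longrightarrow> pairing (fps_X * f) k = (\<Sum>m\<le>N. fps_nth f m * \<nu> k (Suc m))"
  by (subst pairing_extend[of k "Suc N"]) (simp_all add: sum.atMost_Suc_shift del: sum.atMost_Suc)

lemma pairing_shift:
  "pairing (fps_shift 1 f) k = (\<Sum>m\<le>Suc k. fps_nth f m * (case m of 0 \<Rightarrow> 0 | Suc i \<Rightarrow> \<nu> k i))"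
  by (simp add: pairing_def sum.atMost_Suc_shift del: sum.atMost_Suc)

text \<open>Summation by parts moves index shifts of \<open>\<nu>\<close> onto the series:
  \<open>m + 1\<close> becomes multiplication by \<open>fps_X\<close>, and \<open>m - 1\<close>
  becomes \<open>fps_shift 1\<close>. The latter drops the constant coefficient because
  \<open>rec_0\<close> has no \<open>m - 1\<close> term.\<close>

lemma pairing_Suc:
  "pairing ((1 - fps_const A * fps_X) * h) (Suc k)
    = pairing (fps_shift 1 h + fps_const B * h + fps_const C * (fps_X * h)) k"
proof -
  have *: "(1 - fps_const A * fps_X) * h = h - fps_const A * (fps_X * h)"
    by (simp add: algebra_simps)
  have "pairing ((1 - fps_const A * fps_X) * h) (Suc k)
    = (\<Sum>m\<le>Suc k. fps_nth h m * (\<nu> (Suc k) m - A * \<nu> (Suc k) (Suc m)))"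
    unfolding * pairing_diff pairing_scale pairing_X_mult[OF order_refl]
    unfolding pairing_def
    by (simp add: sum_distrib_left sum_subtractf algebra_simps del: sum.atMost_Suc)
  also have "\<dots> = (\<Sum>m\<le>Suc k. fps_nth h m *
      ((case m of 0 \<Rightarrow> 0 | Suc i \<Rightarrow> \<nu> k i) + B * \<nu> k m + C * \<nu> k (Suc m)))"
    using rec_0[of k] rec_Suc[of k] by (intro sum.cong refl) (auto split: nat.split)
  also have "\<dots> = pairing (fps_shift 1 h + fps_const B * h + fps_const C * (fps_X * h)) k"
    unfolding pairing_add pairing_scale pairing_shift pairing_X_mult[of k "Suc k", OF le_SucI[OF order_refl]]
      pairing_extend[of k "Suc k" h, OF le_SucI[OF order_refl]]
    by (simp add: sum_distrib_left sum.distrib algebra_simps del: sum.atMost_Suc)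
  finally show ?thesis .
qed

lemma diagonal: "\<nu> k k = 1"
proof (induction k)
  case (Suc k)
  then show ?case using rec_Suc[of k k] by (simp add: vanish)
qed (rule normalized)

abbreviation lam :: 'a where "lam \<equiv> A\<^sup>2 + A * B + C"

definition geom :: "'a fps" where "geom = inverse (1 - fps_const A * fps_X)"

definition gser :: "'a fps" where "gser = fps_const lam * fps_X * geom"

lemma geom_inverse: "(1 - fps_const A * fps_X) * geom = 1"
  unfolding geom_def by (rule inverse_mult_eq_1') simp

lemma lam_fps:
  "fps_const lam = fps_const A * fps_const A + fps_const A * fps_const B + fps_const C"
  by (simp add: power2_eq_square)

lemma pairing_gser_0: "pairing 1 (Suc k) = pairing gser k + (A + B) * pairing 1 k"
proof -
  let ?a = "fps_const A" and ?b = "fps_const B" and ?c = "fps_const C"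
  have g: "geom = 1 + fps_X * (?a * geom)"
    using geom_inverse by (simp add: algebra_simps)
  have "fps_shift 1 geom = ?a * geom"
  proof -
    have "fps_shift 1 geom = fps_shift 1 (1 + fps_X * (?a * geom))"
      by (rule arg_cong[where f = "fps_shift 1"]) (rule g)
    also have "\<dots> = ?a * geom"
      by (simp add: fps_eq_iff)
    finally show ?thesis .
  qed
  \<comment> \<open>With \<open>h = geom\<close> the left side of \<open>pairing_Suc\<close> is the
    pairing with 1. Adding and subtracting \<open>A (A + B) s geom\<close> produces
    \<open>lam = A (A + B) + C\<close>.\<close>
  then have "fps_shift 1 geom + ?b * geom + ?c * (fps_X * geom)
      = (?a + ?b) * (geom - ?a * fps_X * geom) + (?a * ?a + ?a * ?b + ?c) * fps_X * geom"
    by (simp add: algebra_simps del: fps_const_mult fps_const_add)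
  also have "geom - ?a * fps_X * geom = 1"
    using geom_inverse by (simp add: algebra_simps)
  finally have *: "fps_shift 1 geom + ?b * geom + ?c * (fps_X * geom)
      = gser + fps_const (A + B) * 1"
    unfolding gser_def lam_fps by (simp add: add.commute)
  show ?thesis
    using pairing_Suc[of geom k] unfolding geom_inverse * pairing_add pairing_scale .
qed

lemma pairing_gser_Suc:
  "pairing (gser ^ Suc j) (Suc k)
    = pairing (gser ^ Suc (Suc j)) k + (2 * A + B) * pairing (gser ^ Suc j) k
      + lam * pairing (gser ^ j) k"
proof -
  let ?a = "fps_const A" and ?b = "fps_const B" and ?c = "fps_const C" and ?l = "fps_const lam"
  define q where "q = 1 - ?a * fps_X"
  have q: "q * geom = 1" using geom_inverse by (simp add: q_def)
  \<comment> \<open>A common factor of all terms, given as a product instead of a quotient by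
    \<open>gser\<close>, so \<open>lam = 0\<close> needs no separate case. By \<open>gh\<close> the
    series to be shifted has no constant term and the shift loses nothing, unlike for
    \<open>geom\<close>; hence \<open>2 * A + B\<close> replaces \<open>A + B\<close>.\<close>
  define w where "w = ?l * gser ^ j * geom * geom"
  have gh: "gser ^ Suc j * geom = fps_X * w"
    by (simp add: w_def gser_def mult_ac)
  have h: "fps_shift 1 (fps_X * w) = w"
    by (simp add: fps_eq_iff)
  have g0: "?l * gser ^ j = q * q * w"
  proof -
    have "q * q * w = (q * geom) * (q * geom) * (?l * gser ^ j)"
      by (simp only: w_def mult_ac)
    then show ?thesis by (simp add: q)
  qed
  have g1: "gser ^ Suc j = fps_X * q * w"
  proof -
    have "fps_X * q * w = (q * geom) * (fps_X * ?l * geom * gser ^ j)"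
      by (simp only: w_def mult_ac)
    then show ?thesis by (simp add: q gser_def mult_ac)
  qed
  have g2: "gser ^ Suc (Suc j) = ?l * fps_X * fps_X * w"
    by (simp add: w_def gser_def mult_ac)
  \<comment> \<open>This is \<open>w\<close> times \<open>1 + B s + C s^2 = lam s^2 + (2A + B) s (1
    - A s) + (1 - A s)^2\<close>.\<close>
  have "w + ?b * (fps_X * w) + ?c * (fps_X * (fps_X * w))
      = (?a * ?a + ?a * ?b + ?c) * fps_X * fps_X * w + (?a + ?a + ?b) * (fps_X * q * w) + q * q * w"
    unfolding q_def by (simp add: algebra_simps del: fps_const_mult fps_const_add)
  then have *: "fps_shift 1 (gser ^ Suc j * geom) + ?b * (gser ^ Suc j * geom)
      + ?c * (fps_X * (gser ^ Suc j * geom))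
      = gser ^ Suc (Suc j) + fps_const (2 * A + B) * gser ^ Suc j + ?l * gser ^ j"
    unfolding gh
    unfolding h g2 g0
    unfolding g1 lam_fps
    by (simp only: mult_2 fps_const_add)
  have **: "q * (gser ^ Suc j * geom) = gser ^ Suc j"
    using q by (simp add: mult.left_commute)
  show ?thesis
    using pairing_Suc[of "gser ^ Suc j * geom" k]
    unfolding * q_def[symmetric] ** pairing_add pairing_scale .
qed

text \<open>The factor \<open>s^j\<close> in \<open>gser ^ j\<close> yields triangularity; the
  leading coefficient \<open>lam ^ j\<close> yields the diagonal, since \<open>geom\<close> has
  constant term 1.\<close>

lemma fps_nth_gser_power:
  "fps_nth (gser ^ j) m = (if m < j then 0 else lam ^ j * fps_nth (geom ^ j) (m - j))"
proof -
  have "gser ^ j = fps_const (lam ^ j) * (fps_X ^ j * geom ^ j)"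
    by (simp add: gser_def power_mult_distrib fps_const_power mult.assoc)
  then show ?thesis by (simp add: fps_X_power_mult_nth)
qed

lemma pairing_gser_less: "k < j \<Longrightarrow> pairing (gser ^ j) k = 0"
  unfolding pairing_def by (intro sum.neutral) (auto simp: fps_nth_gser_power)

lemma pairing_gser_diagonal: "pairing (gser ^ j) j = lam ^ j"
proof -
  have "pairing (gser ^ j) j = (\<Sum>m\<in>{j}. fps_nth (gser ^ j) m * \<nu> j m)"
    unfolding pairing_def by (intro sum.mono_neutral_right) (auto simp: fps_nth_gser_power)
  also have "\<dots> = lam ^ j"
    by (simp add: fps_nth_gser_power diagonal geom_def fps_nth_power_0)
  finally show ?thesis .
qed

lemma det_moments: "det (mat n n (\<lambda>(i, j). \<nu> (i + j) 0)) = lam ^ (n choose 2)"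
proof -
  have "det (mat n n (\<lambda>(i, j). \<nu> (i + j) 0)) = (\<Prod>j<n. pairing (gser ^ j) j)"
  proof (rule det_Hankel_three_term
      [where b = "\<lambda>j. if j = 0 then A + B else 2 * A + B" and l = "\<lambda>_. lam"
        and \<mu> = "\<lambda>k. \<nu> k 0" and \<sigma> = "\<lambda>k j. pairing (gser ^ j) k"])
    show "pairing (gser ^ 0) k = \<nu> k 0" for k
    proof -
      have "pairing 1 k = (\<Sum>m\<in>{0}. fps_nth 1 m * \<nu> k m)"
        unfolding pairing_def by (intro sum.mono_neutral_right) auto
      then show ?thesis by simp
    qed
  qed (use pairing_gser_0 pairing_gser_Suc pairing_gser_less in auto)
  also have "\<dots> = lam ^ (\<Sum>j<n. j)"
    by (simp add: pairing_gser_diagonal power_sum)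
  also have "(\<Sum>j<n. j) = n choose 2"
    by (induction n) (simp_all add: numeral_2_eq_2)
  finally show ?thesis .
qed

end

section \<open>From the rational functions \<open>Q_m\<close> to the recurrence for
  \<open>\<nu>\<close>\<close>

lemma RI_ratfun_0: "RI_ratfun A B C 0 = 1"
  by (simp add: RI_ratfun_def RI_denom_def)

lemma RI_ratfun_rec_0:
  assumes "A \<noteq> 0"
  shows "to_fract [:C, A:] * RI_ratfun A B C 1 = to_fract [:- B, 1:]"
  using assms by (simp add: RI_ratfun_def RI_denom_def)

text \<open>Divide the recurrence for \<open>P_(m+2)\<close> by \<open>(Ax + C)^(m+1)\<close>: the
  factor before \<open>P_m\<close> cancels, leaving \<open>Q_m\<close> with a constant
  coefficient.\<close>

lemma RI_ratfun_rec_Suc: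
  assumes "A \<noteq> 0"
  shows "to_fract [:C, A:] * RI_ratfun A B C (Suc (Suc m))
    = to_fract [:- B, 1:] * RI_ratfun A B C (Suc m) - RI_ratfun A B C m"
proof -
  define d where "d = to_fract [:C, A:]"
  have d: "d \<noteq> 0" using assms by (simp add: d_def)
  have den: "to_fract (RI_denom A C k) = d ^ k" for k
    unfolding RI_denom_def d_def
    by (induction k) (simp_all only: power_0 power_Suc to_fract_1 to_fract_mult)
  show ?thesis
    unfolding RI_ratfun_def den RI_poly.simps(3) to_fract_diff to_fract_mult d_def[symmetric]
    using d by (simp add: field_simps)
qed

lemma to_fract_linear: "to_fract [:b, a:] = ratfun_scale b 1 + ratfun_scale a ratfun_X"
proof -
  have "[:b, a:] = [:b:] + [:a:] * [:0, 1:]" by simp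
  then show ?thesis
    by (simp only: to_fract_add to_fract_mult ratfun_scale_def ratfun_X_def mult_1_right)
qed

lemma RI_moments_functional:
  assumes A: "A \<noteq> 0"
    and lin: "linear_functional_on (RI_space A B C) L"
    and L1: "L 1 = 1"
    and L0: "\<And>k m. k < m \<Longrightarrow> L (ratfun_X ^ k * RI_ratfun A B C m) = 0"
  shows "RI_moments A B C (\<lambda>k m. L (ratfun_X ^ k * RI_ratfun A B C m))"
proof -
  define V where "V = RI_space A B C"
  define e where "e k m = ratfun_X ^ k * RI_ratfun A B C m" for k m
  have e: "e k m \<in> V" for k m
    unfolding V_def RI_space_def e_def by (rule ratfun.span_base) blast
  have V_add: "u + v \<in> V" if "u \<in> V" "v \<in> V" for u v
    using that unfolding V_def RI_space_def by (rule ratfun.span_add)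
  have V_scale: "ratfun_scale c u \<in> V" if "u \<in> V" for c u
    using that unfolding V_def RI_space_def by (rule ratfun.span_scale)
  have L_add: "L (u + v) = L u + L v" if "u \<in> V" "v \<in> V" for u v
    using lin that by (simp add: linear_functional_on_def V_def)
  have L_scale: "L (ratfun_scale c u) = c * L u" if "u \<in> V" for c u
    using lin that by (simp add: linear_functional_on_def V_def)
  have linear_mult: "ratfun_X ^ k * (to_fract [:b, a:] * RI_ratfun A B C m)
      = ratfun_scale b (e k m) + ratfun_scale a (e (Suc k) m)" for a b k m
    unfolding to_fract_linear e_def by (simp add: ratfun_scale_def algebra_simps)
  \<comment> \<open>\<open>L\<close> is linear only on \<open>V\<close>, so splitting its argument
    requires the membership facts too.\<close>
  note simps = L_add L_scale V_add V_scale e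
  show ?thesis
  proof
    fix k m :: nat
    show "L (ratfun_X ^ k * RI_ratfun A B C m) = 0" if "k < m" using that by (rule L0)
    have "ratfun_scale C (e k 1) + ratfun_scale A (e (Suc k) 1)
        = ratfun_scale (- B) (e k 0) + ratfun_scale 1 (e (Suc k) 0)"
      unfolding linear_mult[symmetric] RI_ratfun_rec_0[OF A] RI_ratfun_0 by simp
    then have "L (ratfun_scale C (e k 1) + ratfun_scale A (e (Suc k) 1))
        = L (ratfun_scale (- B) (e k 0) + ratfun_scale 1 (e (Suc k) 0))"
      by simp
    then have "C * L (e k 1) + A * L (e (Suc k) 1) = - B * L (e k 0) + 1 * L (e (Suc k) 0)"
      by (simp only: simps)
    then show "L (ratfun_X ^ Suc k * RI_ratfun A B C 0) - A * L (ratfun_X ^ Suc k * RI_ratfun A B C 1)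
        = B * L (ratfun_X ^ k * RI_ratfun A B C 0) + C * L (ratfun_X ^ k * RI_ratfun A B C 1)"
      unfolding e_def[symmetric] by (simp add: algebra_simps)
    have "ratfun_scale C (e k (Suc (Suc m))) + ratfun_scale A (e (Suc k) (Suc (Suc m))) + e k m
        = ratfun_scale (- B) (e k (Suc m)) + ratfun_scale 1 (e (Suc k) (Suc m))"
      unfolding linear_mult[symmetric] RI_ratfun_rec_Suc[OF A]
      by (simp add: e_def right_diff_distrib)
    then have "L (ratfun_scale C (e k (Suc (Suc m))) + ratfun_scale A (e (Suc k) (Suc (Suc m))) + e k m)
        = L (ratfun_scale (- B) (e k (Suc m)) + ratfun_scale 1 (e (Suc k) (Suc m)))"
      by simp
    then have "C * L (e k (Suc (Suc m))) + A * L (e (Suc k) (Suc (Suc m))) + L (e k m)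
        = - B * L (e k (Suc m)) + 1 * L (e (Suc k) (Suc m))"
      by (simp only: simps)
    then show "L (ratfun_X ^ Suc k * RI_ratfun A B C (Suc m))
          - A * L (ratfun_X ^ Suc k * RI_ratfun A B C (Suc (Suc m)))
        = L (ratfun_X ^ k * RI_ratfun A B C m) + B * L (ratfun_X ^ k * RI_ratfun A B C (Suc m))
          + C * L (ratfun_X ^ k * RI_ratfun A B C (Suc (Suc m)))"
      unfolding e_def[symmetric] by (simp add: algebra_simps)
    show "L (ratfun_X ^ 0 * RI_ratfun A B C 0) = 1" by (simp add: RI_ratfun_0 L1)
  qed
qed

theorem theorem6p15:
  fixes A B C :: complex and L :: "ratfun \<Rightarrow> complex" and n :: nat
  assumes "A \<noteq> 0"
    and "\<And>k. k \<ge> 1 \<Longrightarrow> poly (RI_poly A B C k) (- C / A) \<noteq> 0"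
    and "linear_functional_on (RI_space A B C) L"
    and "L 1 = 1"
    and "\<And>k m. k < m \<Longrightarrow> L (ratfun_X ^ k * RI_ratfun A B C m) = 0"
  shows "det (mat (n + 1) (n + 1) (\<lambda>(i, j). L (ratfun_X ^ (i + j))))
           = (A\<^sup>2 + A * B + C) ^ ((n + 1) choose 2)"
proof -
  interpret RI_moments A B C "\<lambda>k m. L (ratfun_X ^ k * RI_ratfun A B C m)"
    using assms(1,3,4,5) by (rule RI_moments_functional)
  \<comment> \<open>Since \<open>Q_0 = 1\<close>, column 0 of \<open>\<nu>\<close> consists of the
    moments of \<open>L\<close>.\<close>
  show ?thesis using det_moments[of "n + 1"] by (simp only: RI_ratfun_0 mult_1_right)
qed

end
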